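(* Let $G$ be a finite group of order $n$. Then $$\sum_{a\in\mathbb{Z}_n^*}\psi\bigl(G_{\gcd(a-1,n)}\bigr)=\varphi(n)\,\sigma(G).$$
   Context: For a finite group $G$ of order $n$, $o(g)$ denotes the order of $g\in G$, and for every divisor $m$ of $n$, $G_m=\{g\in G : g^m=1\}$. Set $\psi(G)=\sum_{g\in G}o(g)$; more generally, for the subset $G_m\subseteq G$ (which need not be a subgroup), $\psi(G_m)=\sum_{g\in G_m}o(g)$. Set $\sigma(G)=\sum_{H\in C(G)}|H|$, where $C(G)$ is the set of cyclic subgroups of $G$. $\mathbb{Z}_n^*=\{a\in\mathbb{N} : 1\le a\le n,\ \gcd(a,n)=1\}$ is the group of units modulo $n$, with the convention $\gcd(0,n)=n$, and $\varphi$ is Euler's totient function. *)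

theory Defs
  imports "HOL-Algebra.Algebra" "HOL-Number_Theory.Totient"
begin

definition roots_of_one :: "('a, 'b) monoid_scheme \<Rightarrow> nat \<Rightarrow> 'a set" where
  "roots_of_one G m = {g \<in> carrier G. g [^]\<^bsub>G\<^esub> m = \<one>\<^bsub>G\<^esub>}"

text \<open>The argument \<open>A\<close> is an arbitrary subset of the carrier; orders are taken in \<open>G\<close>.\<close>

definition psi :: "('a, 'b) monoid_scheme \<Rightarrow> 'a set \<Rightarrow> nat" where
  "psi G A = (\<Sum>g\<in>A. group.ord G g)"

definition cyclic_subgroups :: "('a, 'b) monoid_scheme \<Rightarrow> 'a set set" where
  "cyclic_subgroups G = {H. subgroup H G \<and> cyclic_group (G\<lparr>carrier := H\<rparr>)}"

definition sigma :: "('a, 'b) monoid_scheme \<Rightarrow> nat" where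
  "sigma G = (\<Sum>H\<in>cyclic_subgroups G. card H)"

end

theory Submission
  imports Defs "HOL-Number_Theory.Cong"
begin

text \<open>
  The proof is a double count of the pairs \<open>(a, g)\<close> with \<open>g ^ (a - 1) = 1\<close>, each weighted by the
  order of \<open>g\<close>.  By Lagrange the order \<open>d\<close> of \<open>g\<close> divides \<open>n\<close>, so \<open>g\<close> lies in the set of
  \<open>gcd (a - 1) n\<close>-th roots of one exactly when \<open>a \<equiv> 1 (mod d)\<close>.  Reduction of units modulo \<open>n\<close> to
  units modulo \<open>d\<close> is a surjective homomorphism, hence all its fibres have the same size
  \<open>\<phi>(n) / \<phi>(d)\<close>, and the left-hand side is \<open>\<phi>(n)\<close> times the sum of \<open>d / \<phi>(d)\<close> over all \<open>g\<close>
  (lemma \<open>card_totatives_cong_1\<close>).  When the elements \<open>g\<close> are grouped by the cyclic subgroup \<open>H\<close>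
  that they generate, each \<open>H\<close> occurs once for each of its \<open>\<phi>(|H|)\<close> generators
  (lemma \<open>card_generators_of_cyclic\<close>), so its contribution \<open>\<phi>(|H|) \<cdot> |H| / \<phi>(|H|)\<close> is \<open>|H|\<close>.
  Only the product form \<open>|fibre| \<cdot> \<phi>(d) = \<phi>(n)\<close> is used, which keeps everything in the natural
  numbers.
\<close>

section \<open>Reduction of units modulo a divisor\<close>

lemma ex_totative_cong:
  fixes k m :: nat
  assumes "m > 0" and "coprime k m"
  obtains l where "l \<in> totatives m" and "[k = l] (mod m)"
proof (cases "m = 1")
  case True
  \<comment> \<open>The residue \<open>k mod m = 0\<close> is not a totative here: \<open>totatives 1 = {1}\<close>.\<close>
  then show thesis
    using that[of 1] by (simp add: cong_def)
next
  case False
  have "coprime (k mod m) m"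
    using assms by simp
  moreover from this have "k mod m > 0"
    using False by (metis coprime_0_left_iff gr0I nat_dvd_1_iff_1)
  ultimately have "k mod m \<in> totatives m"
    using assms(1) by (simp add: in_totatives_iff less_imp_le)
  then show thesis
    by (rule that) (simp add: cong_def)
qed

text \<open>
  To make \<open>b\<close> coprime to \<open>n\<close> without changing it modulo \<open>d\<close>, add the multiple of \<open>d\<close> by the
  product of the primes that divide \<open>n\<close> but not \<open>b\<close>.  Each prime factor of \<open>n\<close> then divides
  exactly one of the two summands.
\<close>

lemma ex_coprime_lift:
  fixes b d n :: nat
  assumes "n > 0" and "coprime b d"
  obtains x where "coprime x n" and "[x = b] (mod d)"
proof -
  define P where "P = {p \<in> prime_factors n. \<not> p dvd b}"
  define x where "x = b + d * \<Prod>P"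
  have fin: "finite P"
    by (simp add: P_def)
  have "coprime x n"
  proof (rule ccontr)
    assume "\<not> coprime x n"
    then obtain p where p: "Factorial_Ring.prime p" "p dvd x" "p dvd n"
      using prime_factor_nat[of "gcd x n"] by (auto simp: coprime_iff_gcd_eq_1)
    show False
    proof (cases "p dvd b")
      case True
      then have "p dvd d * \<Prod>P"
        using p(2) by (simp add: x_def dvd_add_right_iff)
      moreover have "\<not> p dvd d"
        using True assms(2) p(1) by (meson coprime_common_divisor not_prime_unit)
      ultimately have "p dvd \<Prod>P"
        using p(1) prime_dvd_mult_iff by blast
      then obtain q where "q \<in> P" "p dvd q"
        using fin p(1) by (auto simp: prime_dvd_prod_iff)
      then have "q = p"
        using p(1) primes_dvd_imp_eq by (auto simp: P_def in_prime_factors_iff)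
      with True \<open>q \<in> P\<close> show False
        by (simp add: P_def)
    next
      case False
      then have "p \<in> P"
        using p assms(1) by (simp add: P_def in_prime_factors_iff)
      then have "p dvd d * \<Prod>P"
        using fin dvd_prodI[of P p "\<lambda>p. p"] by (simp add: dvd_mult)
      with p(2) False show False
        by (simp add: x_def dvd_add_left_iff)
    qed
  qed
  moreover have "[x = b] (mod d)"
    by (simp add: x_def cong_def)
  ultimately show thesis
    by (rule that)
qed

text \<open>
  Multiplication by a unit \<open>x\<close> modulo \<open>n\<close> that lifts \<open>b\<close> carries the fibre over \<open>1\<close> onto the fibre
  over \<open>b\<close>; multiplication by the inverse of \<open>x\<close> carries it back.
\<close>

lemma card_totatives_cong:
  fixes b d n :: nat
  assumes "n > 0" and "d dvd n" and "coprime b d"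
  shows "card {a \<in> totatives n. [a = b] (mod d)} = card {a \<in> totatives n. [a = 1] (mod d)}"
proof (cases "n = 1")
  case True
  then have "d = 1"
    using assms(2) by simp
  then show ?thesis
    by (simp add: cong_def)
next
  case False
  then have n: "n > 1"
    using assms(1) by simp
  obtain x where x: "coprime x n" "[x = b] (mod d)"
    using ex_coprime_lift assms by blast
  obtain y where y: "[x * y = 1] (mod n)"
    using x(1) cong_solve_coprime_nat by auto
  have cop_y: "coprime y n"
    using y by (metis coprime_iff_invertible_nat mult.commute One_nat_def)
  have maps: "(z * a) mod n \<in> {a \<in> totatives n. [a = c] (mod d)}"
    if "coprime z n" "[z * e = c] (mod d)" "a \<in> {a \<in> totatives n. [a = e] (mod d)}" for z a c e
  proof -
    have cop: "coprime ((z * a) mod n) n"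
      using that(1,3) n by (simp add: in_totatives_iff)
    moreover have "(z * a) mod n > 0"
      using cop n by (metis coprime_0_left_iff gr0I nat_dvd_1_iff_1 less_irrefl)
    moreover have "[(z * a) mod n = c] (mod d)"
    proof -
      have "[(z * a) mod n = z * a] (mod d)"
        using assms(2) by (simp add: cong_def mod_mod_cancel)
      also have "[z * a = z * e] (mod d)"
        using that(3) by (simp add: cong_scalar_left)
      also note that(2)
      finally show ?thesis .
    qed
    ultimately show ?thesis
      using n by (simp add: in_totatives_iff less_imp_le)
  qed
  have inverse: "(u * ((v * a) mod n)) mod n = a"
    if "[u * v = 1] (mod n)" "a \<in> totatives n" for u v a
  proof -
    have "[u * ((v * a) mod n) = u * v * a] (mod n)"
      by (simp add: cong_def mod_mult_right_eq mult.assoc)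
    also have "[u * v * a = 1 * a] (mod n)"
      using that(1) by (rule cong_scalar_right)
    finally show ?thesis
      using totatives_less[OF that(2) n] by (simp add: cong_def)
  qed
  have yb: "[y * b = 1] (mod d)"
  proof -
    have "[y * b = y * x] (mod d)"
      using x(2) cong_scalar_left cong_sym by blast
    also have "[y * x = 1] (mod d)"
      using y assms(2) cong_dvd_modulus_nat by (metis mult.commute)
    finally show ?thesis .
  qed
  have "bij_betw (\<lambda>a. (x * a) mod n)
          {a \<in> totatives n. [a = 1] (mod d)} {a \<in> totatives n. [a = b] (mod d)}"
  proof (rule bij_betw_byWitness[where f' = "\<lambda>a. (y * a) mod n"])
    show "(\<lambda>a. (x * a) mod n) ` {a \<in> totatives n. [a = 1] (mod d)}
        \<subseteq> {a \<in> totatives n. [a = b] (mod d)}"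
      using maps[of x 1 b] x by auto
    show "(\<lambda>a. (y * a) mod n) ` {a \<in> totatives n. [a = b] (mod d)}
        \<subseteq> {a \<in> totatives n. [a = 1] (mod d)}"
      using maps[of y b 1] cop_y yb by auto
  qed (use y inverse[of x y] inverse[of y x] in \<open>simp_all add: mult.commute[of y x]\<close>)
  then show ?thesis
    by (simp add: bij_betw_same_card)
qed

text \<open>
  The fibres over the \<open>\<phi>(d)\<close> units modulo \<open>d\<close> partition the units modulo \<open>n\<close>, and all of them are
  as large as the fibre over \<open>1\<close>.
\<close>

lemma card_totatives_cong_1:
  fixes d n :: nat
  assumes "n > 0" and "d dvd n"
  shows "card {a \<in> totatives n. [a = 1] (mod d)} * totient d = totient n"
proof -
  define F where "F b = {a \<in> totatives n. [a = b] (mod d)}" for b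
  have d: "d > 0"
    using assms dvd_pos_nat by blast
  have cover: "\<exists>b\<in>totatives d. [a = b] (mod d)" if "a \<in> totatives n" for a
  proof -
    have "coprime a d"
      using that assms(2) by (auto simp: in_totatives_iff intro: coprime_divisors)
    then show ?thesis
      using ex_totative_cong d by blast
  qed
  have unique: "b = c" if "b \<in> totatives d" "c \<in> totatives d" "[b = c] (mod d)" for b c
  proof (cases "d = 1")
    case True
    with that show ?thesis by simp
  next
    case False
    with d that show ?thesis
      by (metis cong_less_modulus_unique_nat totatives_less nat_neq_iff less_one)
  qed
  have "totatives n = (\<Union>b\<in>totatives d. F b)"
    using cover by (auto simp: F_def)
  then have "totient n = card (\<Union>b\<in>totatives d. F b)"
    by (simp add: totient_def)
  also have "\<dots> = (\<Sum>b\<in>totatives d. card (F b))"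
  proof (rule card_UN_disjoint)
    show "\<forall>b\<in>totatives d. \<forall>c\<in>totatives d. b \<noteq> c \<longrightarrow> F b \<inter> F c = {}"
    proof (intro ballI impI equals0I)
      fix b c a
      assume bc: "b \<in> totatives d" "c \<in> totatives d" "b \<noteq> c" and "a \<in> F b \<inter> F c"
      then have "[b = c] (mod d)"
        by (auto simp: F_def cong_def)
      with bc unique show False
        by blast
    qed
  qed (auto simp: F_def)
  also have "\<dots> = (\<Sum>b\<in>totatives d. card (F 1))"
    unfolding F_def using assms
    by (intro sum.cong refl card_totatives_cong) (auto simp: in_totatives_iff)
  finally show ?thesis
    by (simp add: F_def totient_def mult.commute)
qed

section \<open>Cyclic subgroups and their generators\<close>

lemma (in group) cyclic_subgroups_eq_generate:
  "cyclic_subgroups G = (\<lambda>g. generate G {g}) ` carrier G"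
proof (intro equalityI subsetI)
  fix H
  assume "H \<in> cyclic_subgroups G"
  then have H: "subgroup H G" and cyc: "cyclic_group (G\<lparr>carrier := H\<rparr>)"
    by (auto simp: cyclic_subgroups_def)
  obtain g where g: "g \<in> H" and "subgroup_generated (G\<lparr>carrier := H\<rparr>) {g} = G\<lparr>carrier := H\<rparr>"
    using cyc by (auto simp: cyclic_group_def)
  then have "carrier (subgroup_generated (G\<lparr>carrier := H\<rparr>) {g}) = H"
    by simp
  then have "generate (G\<lparr>carrier := H\<rparr>) {g} = H"
    using g by (simp add: carrier_subgroup_generated)
  then have "generate G {g} = H"
    using generate_consistent[of "{g}" H] g H by simp
  then show "H \<in> (\<lambda>g. generate G {g}) ` carrier G"
    using subgroup.mem_carrier[OF H g] by blast
next
  fix H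
  assume "H \<in> (\<lambda>g. generate G {g}) ` carrier G"
  then obtain g where g: "g \<in> carrier G" and H: "H = generate G {g}"
    by blast
  have "G\<lparr>carrier := H\<rparr> = subgroup_generated G {g}"
    using g by (simp add: H subgroup_generated_def)
  then show "H \<in> cyclic_subgroups G"
    using g cyclic_group_generated[of g] generate_is_subgroup[of "{g}"]
    by (simp add: cyclic_subgroups_def H)
qed

text \<open>
  In a finite cyclic group generated by \<open>h\<close>, an element generates the whole group exactly when it
  has the same order as \<open>h\<close>, and \<open>h ^ k\<close> has that order exactly when \<open>k\<close> is coprime to it.
\<close>

lemma (in group) card_generators_of_cyclic:
  assumes "ord h > 0" and "h \<in> carrier G"
  shows "card {g \<in> carrier G. generate G {g} = generate G {h}} = totient (ord h)"
proof -
  let ?H = "generate G {h}"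
  have sub: "subgroup ?H G"
    using assms(2) by (simp add: generate_is_subgroup)
  have fin: "finite ?H"
    using assms generate_pow_card card_ge_0_finite by metis
  have powers: "?H = {h [^] k | k. k \<in> (UNIV :: nat set)}"
    using generate_pow_nat assms by simp
  have gen_iff: "generate G {h [^] k} = ?H \<longleftrightarrow> coprime k (ord h)" for k :: nat
  proof -
    have "generate G {h [^] k} \<subseteq> ?H"
      using powers by (intro generate_subgroup_incl[OF _ sub]) blast
    then have "generate G {h [^] k} = ?H \<longleftrightarrow> ord (h [^] k) = ord h"
      using fin card_subset_eq generate_pow_card assms(2) by (metis nat_pow_closed)
    also have "\<dots> \<longleftrightarrow> coprime k (ord h)"
    proof -
      have "ord h div gcd (ord h) k = ord h \<longleftrightarrow> gcd (ord h) k = 1"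
        using assms(1) by (metis div_by_1 div_eq_dividend_iff)
      then show ?thesis
        using assms by (auto simp: ord_pow_gen coprime_iff_gcd_eq_1 gcd.commute)
    qed
    finally show ?thesis .
  qed
  have "bij_betw (\<lambda>k. h [^] k) (totatives (ord h)) {g \<in> carrier G. generate G {g} = ?H}"
    unfolding bij_betw_def
  proof
    show "inj_on (\<lambda>k. h [^] k) (totatives (ord h))"
      using ord_inj'[OF assms(2)]
      by (rule inj_on_subset) (auto simp: in_totatives_iff)
    show "(\<lambda>k. h [^] k) ` totatives (ord h) = {g \<in> carrier G. generate G {g} = ?H}"
    proof (intro equalityI subsetI)
      fix g
      assume "g \<in> (\<lambda>k. h [^] k) ` totatives (ord h)"
      then show "g \<in> {g \<in> carrier G. generate G {g} = ?H}"
        using assms(2) gen_iff by (force simp: in_totatives_iff)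
    next
      fix g
      assume g: "g \<in> {g \<in> carrier G. generate G {g} = ?H}"
      then have "g \<in> ?H"
        using generate.incl[of g "{g}" G] by simp
      then obtain k :: nat where k: "g = h [^] k"
        using powers by blast
      then have "coprime k (ord h)"
        using g gen_iff by simp
      \<comment> \<open>\<open>k\<close> need not be a residue, so it is replaced by the totative to which it is congruent.\<close>
      then obtain l where l: "l \<in> totatives (ord h)" "[k = l] (mod ord h)"
        using ex_totative_cong[OF assms(1)] by blast
      have "int (ord h) dvd int l - int k"
        using l(2) by (simp add: cong_int_iff[symmetric] cong_iff_dvd_diff dvd_diff_commute)
      then have "h [^] k = h [^] l"
        using int_pow_eq[OF assms(2), of "int k" "int l"] by (simp add: int_pow_int)
      then show "g \<in> (\<lambda>k. h [^] k) ` totatives (ord h)"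
        using k l(1) by blast
    qed
  qed
  then show ?thesis
    by (simp add: totient_def bij_betw_same_card[symmetric])
qed

section \<open>The double count\<close>

text \<open>
  By Lagrange the order of \<open>g\<close> always divides the second argument of the gcd, so only the
  condition on \<open>a - 1\<close> remains.  The subtraction must not truncate, hence \<open>a > 0\<close>.
\<close>

lemma (in group) mem_roots_of_one_gcd_iff:
  assumes "g \<in> carrier G" and "a > 0"
  shows "g \<in> roots_of_one G (gcd (a - 1) (order G)) \<longleftrightarrow> [a = 1] (mod ord g)"
proof -
  have "g \<in> roots_of_one G (gcd (a - 1) (order G)) \<longleftrightarrow> ord g dvd a - 1"
    using assms(1) ord_dvd_group_order by (simp add: roots_of_one_def pow_eq_id)
  also have "\<dots> \<longleftrightarrow> [a = 1] (mod ord g)"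
    using assms(2) by (simp add: cong_altdef_nat)
  finally show ?thesis .
qed

theorem theorem1:
  fixes G :: "('a, 'b) monoid_scheme" and n :: nat
  assumes "group G" and "finite (carrier G)" and "order G = n"
  shows "(\<Sum>a\<in>totatives n. psi G (roots_of_one G (gcd (a - 1) n))) = totient n * sigma G"
proof -
  interpret group G by fact
  have n: "n > 0"
    using assms(2,3) order_gt_0_iff_finite by blast
  define c where "c d = card {a \<in> totatives n. [a = 1] (mod d)}" for d
  let ?gen = "\<lambda>g. generate G {g}"
  have "(\<Sum>a\<in>totatives n. psi G (roots_of_one G (gcd (a - 1) n)))
      = (\<Sum>a\<in>totatives n. \<Sum>g | g \<in> carrier G \<and> [a = 1] (mod ord g). ord g)"
  proof (rule sum.cong)
    fix a
    assume "a \<in> totatives n"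
    then have "roots_of_one G (gcd (a - 1) n) = {g \<in> carrier G. [a = 1] (mod ord g)}"
      using mem_roots_of_one_gcd_iff[of _ a] assms(3)
      by (auto simp: in_totatives_iff roots_of_one_def)
    then show "psi G (roots_of_one G (gcd (a - 1) n))
        = (\<Sum>g | g \<in> carrier G \<and> [a = 1] (mod ord g). ord g)"
      by (simp add: psi_def)
  qed simp
  also have "\<dots> = (\<Sum>g\<in>carrier G. \<Sum>a | a \<in> totatives n \<and> [a = 1] (mod ord g). ord g)"
    by (rule sum.swap_restrict) (use assms(2) in auto)
  also have "\<dots> = (\<Sum>g\<in>carrier G. c (ord g) * ord g)"
    by (simp add: c_def)
  also have "\<dots> = (\<Sum>H\<in>?gen ` carrier G. \<Sum>g | g \<in> carrier G \<and> ?gen g = H. c (ord g) * ord g)"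
    by (rule sum.image_gen[OF assms(2)])
  also have "\<dots> = (\<Sum>H\<in>?gen ` carrier G. totient n * card H)"
  proof (rule sum.cong)
    fix H
    assume "H \<in> ?gen ` carrier G"
    then obtain h where h: "h \<in> carrier G" and H: "H = ?gen h"
      by blast
    have "ord g = card H" if "g \<in> carrier G" "?gen g = H" for g
      using that generate_pow_card by simp
    then have "(\<Sum>g | g \<in> carrier G \<and> ?gen g = H. c (ord g) * ord g)
        = (\<Sum>g | g \<in> carrier G \<and> ?gen g = H. c (card H) * card H)"
      by (intro sum.cong) auto
    also have "\<dots> = (c (card H) * totient (card H)) * card H"
      using card_generators_of_cyclic[OF _ h] ord_ge_1[OF assms(2) h] generate_pow_card[OF h] H
      by simp
    also have "c (card H) * totient (card H) = totient n"
      using card_totatives_cong_1[OF n, of "card H"] ord_dvd_group_order[OF h] assms(3)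
      by (simp add: c_def H generate_pow_card[OF h])
    finally show "(\<Sum>g | g \<in> carrier G \<and> ?gen g = H. c (ord g) * ord g) = totient n * card H" .
  qed simp
  also have "\<dots> = totient n * sigma G"
    by (simp add: sigma_def cyclic_subgroups_eq_generate sum_distrib_left)
  finally show ?thesis .
qed

end
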